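(* Let $(A,\{-,-,-\})$ be a Lie truss (respectively, a heap of Lie affebras over a field $\mathbb{F}$). Then, for all $o\in A$, the retract $A(o)$ is a Lie ring (respectively, a Lie algebra over $\mathbb{F}$) with the bracket $$[a,b]=\{a,o,b\}-\{a,o,o\}-\{o,o,b\},\qquad a,b\in A,$$ where the subtraction is in the abelian group $A(o)$.
   Context: **Abelian heaps.** An abelian heap is a set $A$ with a ternary operation $[-,-,-]:A\times A\times A\to A$ such that for all $a_1,\dots,a_5\in A$: $[a_1,a_2,[a_3,a_4,a_5]]=[[a_1,a_2,a_3],a_4,a_5]$; $[a_1,a_2,a_2]=a_1=[a_2,a_2,a_1]$; $[a_1,a_2,a_3]=[a_3,a_2,a_1]$. A heap homomorphism is a map $f$ with $f([a_1,a_2,a_3])=[f(a_1),f(a_2),f(a_3)]$. For an odd number of elements, $[a_1,a_2,\dots,a_{2n+1}]$ denotes the repeated application of $[-,-,-]$; its value does not depend on the placing of brackets. For $o\in A$, the retract $A(o)$ is the abelian group on the set $A$ with neutral element $o$, addition $a+b=[a,o,b]$ and inverses $-a=[o,a,o]$. The ternary heap operation $[a,b,c]$ should not be confused with the binary bracket $[a,b]$. **Affine spaces.** An affine space over a field $\mathbb{F}$ is a non-empty abelian heap $A$ with an operation $\Lambda:\mathbb{F}\times A\times A\to A$ such that for all $\alpha,\beta,\gamma\in\mathbb{F}$, $a,b,c,d\in A$: - $\Lambda(\alpha-\beta+\gamma,a,b)=[\Lambda(\alpha,a,b),\Lambda(\beta,a,b),\Lambda(\gamma,a,b)]$; - $\Lambda(\alpha,a,[b,c,d])=[\Lambda(\alpha,a,b),\Lambda(\alpha,a,c),\Lambda(\alpha,a,d)]$;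 - $\Lambda(\alpha\beta,a,b)=\Lambda(\alpha,a,\Lambda(\beta,a,b))$; - $\Lambda(\alpha,a,b)=[\Lambda(\alpha,c,b),\Lambda(\alpha,c,a),a]$; - $\Lambda(0,a,b)=a=\Lambda(1,b,a)$. An affine transformation is a heap homomorphism $f$ with $f(\Lambda(\alpha,a,b))=\Lambda(\alpha,f(a),f(b))$. For an affine space $A$ and $o\in A$, the group $A(o)$ is an $\mathbb{F}$-vector space with $\alpha a=\Lambda(\alpha,o,a)$. **Lie trusses and heaps of Lie affebras.** A Lie bracket on an abelian heap $A$ is a function $\{-,-,-\}:A\times A\times A\to A$ such that for all $a,b\in A$ the maps $\{a,b,-\},\{a,-,b\},\{-,a,b\}:A\to A$ are heap homomorphisms and for all $a,b,c,o\in A$: - $\{a,b,a\}=b$; - $\big[\{a,b,c\},b,\{c,b,a\}\big]=b$; - $\{\{a,o,b\},o,c\}=\Big[\{o,o,a\},\{\{b,o,c\},o,a\},\{o,o,b\},\{\{c,o,a\},o,b\},\{o,o,c\}\Big]$. An abelian heap with a Lie bracket is called a Lie truss. If $A$ is an affine space and for all $a,b\in A$ the maps $\{a,b,-\},\{a,-,b\},\{-,a,b\}:A\to A$ are affine transformations, then $A$ with such a Lie bracket is called a heap of Lie affebras. *)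

theory Defs
  imports "HOL-Algebra.Module"
begin

locale abelian_heap =
  fixes A :: "'a set" and h :: "'a \<Rightarrow> 'a \<Rightarrow> 'a \<Rightarrow> 'a"
  assumes heap_closed:
      "\<lbrakk>a \<in> A; b \<in> A; c \<in> A\<rbrakk> \<Longrightarrow> h a b c \<in> A"
    and heap_assoc:
      "\<lbrakk>a \<in> A; b \<in> A; c \<in> A; d \<in> A; e \<in> A\<rbrakk> \<Longrightarrow> h a b (h c d e) = h (h a b c) d e"
    and heap_right_cancel: "\<lbrakk>a \<in> A; b \<in> A\<rbrakk> \<Longrightarrow> h a b b = a"
    and heap_left_cancel: "\<lbrakk>a \<in> A; b \<in> A\<rbrakk> \<Longrightarrow> h b b a = a"
    and heap_comm: "\<lbrakk>a \<in> A; b \<in> A; c \<in> A\<rbrakk> \<Longrightarrow> h a b c = h c b a"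

definition heap_hom ::
    "'a set \<Rightarrow> ('a \<Rightarrow> 'a \<Rightarrow> 'a \<Rightarrow> 'a) \<Rightarrow> 'b set \<Rightarrow> ('b \<Rightarrow> 'b \<Rightarrow> 'b \<Rightarrow> 'b) \<Rightarrow> ('a \<Rightarrow> 'b) \<Rightarrow> bool"
  where "heap_hom A h B k f \<longleftrightarrow>
    f \<in> A \<rightarrow> B \<and> (\<forall>a\<in>A. \<forall>b\<in>A. \<forall>c\<in>A. f (h a b c) = k (f a) (f b) (f c))"

text \<open>The value of the five-fold bracket does not depend on how it is parenthesised.\<close>

definition heap5 :: "('a \<Rightarrow> 'a \<Rightarrow> 'a \<Rightarrow> 'a) \<Rightarrow> 'a \<Rightarrow> 'a \<Rightarrow> 'a \<Rightarrow> 'a \<Rightarrow> 'a \<Rightarrow> 'a"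
  where "heap5 h a b c d e = h (h a b c) d e"

locale affine_space = field F + abelian_heap A h
  for F :: "('f, 'm) ring_scheme" (structure)
    and A :: "'a set" and h :: "'a \<Rightarrow> 'a \<Rightarrow> 'a \<Rightarrow> 'a" +
  fixes \<Lambda> :: "'f \<Rightarrow> 'a \<Rightarrow> 'a \<Rightarrow> 'a"
  assumes nonempty: "A \<noteq> {}"
    and act_closed:
      "\<lbrakk>\<alpha> \<in> carrier F; a \<in> A; b \<in> A\<rbrakk> \<Longrightarrow> \<Lambda> \<alpha> a b \<in> A"
    and act_scalar_heap:
      "\<lbrakk>\<alpha> \<in> carrier F; \<beta> \<in> carrier F; \<gamma> \<in> carrier F; a \<in> A; b \<in> A\<rbrakk>
       \<Longrightarrow> \<Lambda> (\<alpha> \<ominus> \<beta> \<oplus> \<gamma>) a b = h (\<Lambda> \<alpha> a b) (\<Lambda> \<beta> a b) (\<Lambda> \<gamma> a b)"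
    and act_heap:
      "\<lbrakk>\<alpha> \<in> carrier F; a \<in> A; b \<in> A; c \<in> A; d \<in> A\<rbrakk>
       \<Longrightarrow> \<Lambda> \<alpha> a (h b c d) = h (\<Lambda> \<alpha> a b) (\<Lambda> \<alpha> a c) (\<Lambda> \<alpha> a d)"
    and act_mult:
      "\<lbrakk>\<alpha> \<in> carrier F; \<beta> \<in> carrier F; a \<in> A; b \<in> A\<rbrakk>
       \<Longrightarrow> \<Lambda> (\<alpha> \<otimes> \<beta>) a b = \<Lambda> \<alpha> a (\<Lambda> \<beta> a b)"
    and act_base_change:
      "\<lbrakk>\<alpha> \<in> carrier F; a \<in> A; b \<in> A; c \<in> A\<rbrakk>
       \<Longrightarrow> \<Lambda> \<alpha> a b = h (\<Lambda> \<alpha> c b) (\<Lambda> \<alpha> c a) a"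
    and act_zero: "\<lbrakk>a \<in> A; b \<in> A\<rbrakk> \<Longrightarrow> \<Lambda> \<zero> a b = a"
    and act_one: "\<lbrakk>a \<in> A; b \<in> A\<rbrakk> \<Longrightarrow> \<Lambda> \<one> b a = a"

definition affine_transformation ::
    "('f, 'm) ring_scheme \<Rightarrow> 'a set \<Rightarrow> ('a \<Rightarrow> 'a \<Rightarrow> 'a \<Rightarrow> 'a) \<Rightarrow> ('f \<Rightarrow> 'a \<Rightarrow> 'a \<Rightarrow> 'a)
      \<Rightarrow> 'b set \<Rightarrow> ('b \<Rightarrow> 'b \<Rightarrow> 'b \<Rightarrow> 'b) \<Rightarrow> ('f \<Rightarrow> 'b \<Rightarrow> 'b \<Rightarrow> 'b) \<Rightarrow> ('a \<Rightarrow> 'b) \<Rightarrow> bool"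
  where "affine_transformation F A h \<Lambda> B k \<Lambda>' f \<longleftrightarrow>
    heap_hom A h B k f \<and>
    (\<forall>\<alpha>\<in>carrier F. \<forall>a\<in>A. \<forall>b\<in>A. f (\<Lambda> \<alpha> a b) = \<Lambda>' \<alpha> (f a) (f b))"

locale lie_truss = abelian_heap A h
  for A :: "'a set" and h :: "'a \<Rightarrow> 'a \<Rightarrow> 'a \<Rightarrow> 'a" +
  fixes br :: "'a \<Rightarrow> 'a \<Rightarrow> 'a \<Rightarrow> 'a"
  assumes br_closed: "\<lbrakk>a \<in> A; b \<in> A; c \<in> A\<rbrakk> \<Longrightarrow> br a b c \<in> A"
    and br_hom3: "\<lbrakk>a \<in> A; b \<in> A\<rbrakk> \<Longrightarrow> heap_hom A h A h (\<lambda>x. br a b x)"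
    and br_hom2: "\<lbrakk>a \<in> A; b \<in> A\<rbrakk> \<Longrightarrow> heap_hom A h A h (\<lambda>x. br a x b)"
    and br_hom1: "\<lbrakk>a \<in> A; b \<in> A\<rbrakk> \<Longrightarrow> heap_hom A h A h (\<lambda>x. br x a b)"
    and br_idem: "\<lbrakk>a \<in> A; b \<in> A\<rbrakk> \<Longrightarrow> br a b a = b"
    and br_antisym: "\<lbrakk>a \<in> A; b \<in> A; c \<in> A\<rbrakk> \<Longrightarrow> h (br a b c) b (br c b a) = b"
    and br_jacobi:
      "\<lbrakk>a \<in> A; b \<in> A; c \<in> A; u \<in> A\<rbrakk> \<Longrightarrow>
       br (br a u b) u c =
       heap5 h (br u u a) (br (br b u c) u a) (br u u b) (br (br c u a) u b) (br u u c)"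

locale lie_affebra_heap = affine_space F A h \<Lambda> + lie_truss A h br
  for F :: "('f, 'm) ring_scheme" (structure)
    and A :: "'a set" and h :: "'a \<Rightarrow> 'a \<Rightarrow> 'a \<Rightarrow> 'a"
    and \<Lambda> :: "'f \<Rightarrow> 'a \<Rightarrow> 'a \<Rightarrow> 'a" and br :: "'a \<Rightarrow> 'a \<Rightarrow> 'a \<Rightarrow> 'a" +
  assumes br_affine3:
      "\<lbrakk>a \<in> A; b \<in> A\<rbrakk> \<Longrightarrow> affine_transformation F A h \<Lambda> A h \<Lambda> (\<lambda>x. br a b x)"
    and br_affine2:
      "\<lbrakk>a \<in> A; b \<in> A\<rbrakk> \<Longrightarrow> affine_transformation F A h \<Lambda> A h \<Lambda> (\<lambda>x. br a x b)"
    and br_affine1: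
      "\<lbrakk>a \<in> A; b \<in> A\<rbrakk> \<Longrightarrow> affine_transformation F A h \<Lambda> A h \<Lambda> (\<lambda>x. br x a b)"

text \<open>
  The additive groups and modules of HOL-Algebra live in the ring record, whose fields
  \<open>mult\<close> and \<open>one\<close> are ignored by \<^locale>\<open>abelian_group\<close> and \<^locale>\<open>module\<close>. They are left
  unspecified in the retract, and the Lie bracket is a separate parameter below.
\<close>

locale lie_ring = abelian_group L
  for L :: "('a, 'm) ring_scheme" (structure) +
  fixes lb :: "'a \<Rightarrow> 'a \<Rightarrow> 'a"
  assumes lb_closed: "\<lbrakk>a \<in> carrier L; b \<in> carrier L\<rbrakk> \<Longrightarrow> lb a b \<in> carrier L"
    and lb_add_left:
      "\<lbrakk>a \<in> carrier L; b \<in> carrier L; c \<in> carrier L\<rbrakk> \<Longrightarrow> lb (a \<oplus> b) c = lb a c \<oplus> lb b c"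
    and lb_add_right:
      "\<lbrakk>a \<in> carrier L; b \<in> carrier L; c \<in> carrier L\<rbrakk> \<Longrightarrow> lb a (b \<oplus> c) = lb a b \<oplus> lb a c"
    and lb_alternating: "a \<in> carrier L \<Longrightarrow> lb a a = \<zero>"
    and lb_jacobi:
      "\<lbrakk>a \<in> carrier L; b \<in> carrier L; c \<in> carrier L\<rbrakk>
       \<Longrightarrow> lb (lb a b) c \<oplus> lb (lb b c) a \<oplus> lb (lb c a) b = \<zero>"

locale lie_algebra = field F + module F L + lie_ring L lb
  for F :: "('f, 'n) ring_scheme"
    and L :: "('f, 'a, 'm) module_scheme" and lb :: "'a \<Rightarrow> 'a \<Rightarrow> 'a" +
  assumes lb_smult_left:
      "\<lbrakk>\<alpha> \<in> carrier F; a \<in> carrier L; b \<in> carrier L\<rbrakk>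
       \<Longrightarrow> lb (\<alpha> \<odot>\<^bsub>L\<^esub> a) b = \<alpha> \<odot>\<^bsub>L\<^esub> lb a b"
    and lb_smult_right:
      "\<lbrakk>\<alpha> \<in> carrier F; a \<in> carrier L; b \<in> carrier L\<rbrakk>
       \<Longrightarrow> lb a (\<alpha> \<odot>\<^bsub>L\<^esub> b) = \<alpha> \<odot>\<^bsub>L\<^esub> lb a b"

definition retract :: "'a set \<Rightarrow> ('a \<Rightarrow> 'a \<Rightarrow> 'a \<Rightarrow> 'a) \<Rightarrow> 'a \<Rightarrow> 'a ring"
  where "retract A h u =
    \<lparr>carrier = A, mult = undefined, one = undefined, zero = u, add = (\<lambda>a b. h a u b)\<rparr>"

definition retract_module ::
    "'a set \<Rightarrow> ('a \<Rightarrow> 'a \<Rightarrow> 'a \<Rightarrow> 'a) \<Rightarrow> ('f \<Rightarrow> 'a \<Rightarrow> 'a \<Rightarrow> 'a) \<Rightarrow> 'a \<Rightarrow> ('f, 'a) module"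
  where "retract_module A h \<Lambda> u =
    \<lparr>carrier = A, mult = undefined, one = undefined, zero = u, add = (\<lambda>a b. h a u b),
     smult = (\<lambda>\<alpha> a. \<Lambda> \<alpha> u a)\<rparr>"

definition retract_bracket ::
    "'a set \<Rightarrow> ('a \<Rightarrow> 'a \<Rightarrow> 'a \<Rightarrow> 'a) \<Rightarrow> ('a \<Rightarrow> 'a \<Rightarrow> 'a \<Rightarrow> 'a) \<Rightarrow> 'a \<Rightarrow> 'a \<Rightarrow> 'a \<Rightarrow> 'a"
  where "retract_bracket A h br u a b =
    br a u b \<ominus>\<^bsub>retract A h u\<^esub> br a u u \<ominus>\<^bsub>retract A h u\<^esub> br u u b"

text \<open>
  The additive inverse of HOL-Algebra is defined from the addition and the zero; on the retract it
  is the one given by the heap operation.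
\<close>

lemma (in abelian_heap) retract_abelian_group:
  assumes u: "u \<in> A"
  shows "abelian_group (retract A h u)"
proof (rule abelian_groupI)
  fix x assume "x \<in> carrier (retract A h u)"
  then have x: "x \<in> A" by (simp add: retract_def)
  have "h (h u x u) u x = u"
    using u x by (metis heap_assoc heap_left_cancel heap_right_cancel)
  then show "\<exists>y\<in>carrier (retract A h u). y \<oplus>\<^bsub>retract A h u\<^esub> x = \<zero>\<^bsub>retract A h u\<^esub>"
    using u x heap_closed by (auto simp: retract_def)
qed (use u in \<open>auto simp: retract_def heap_closed heap_assoc heap_left_cancel intro: heap_comm\<close>)

lemma (in abelian_heap) retract_a_inv:
  assumes u: "u \<in> A" and x: "x \<in> A"
  shows "\<ominus>\<^bsub>retract A h u\<^esub> x = h u x u"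
proof -
  interpret G: abelian_group "retract A h u"
    using u by (rule retract_abelian_group)
  have "h (h u x u) u x = u"
    using u x by (metis heap_assoc heap_left_cancel heap_right_cancel)
  then show ?thesis
    using u x heap_closed by (intro G.minus_equality) (auto simp: retract_def)
qed

end

theory Submission
  imports Defs
begin

text \<open>
  In the retract at \<open>u\<close> the heap operation is \<open>a - b + c\<close>, so \<open>f a b = br a u b\<close> is affine in each
  argument and vanishes at \<open>(0, 0)\<close>. Hence it is the sum of a biadditive map \<open>B\<close>, which is the
  bracket, and the two additive maps \<open>f a 0\<close> and \<open>f 0 b\<close>, which are \<open>- R a\<close> and \<open>R b\<close> by
  antisymmetry. Setting \<open>c = 0\<close> in the heap Jacobi identity shows that \<open>R\<close> is a derivation of \<open>B\<close>;
  the terms involving \<open>R\<close> in the general identity then cancel, leaving the Jacobi identity for \<open>B\<close>.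
\<close>

lemma (in abelian_group) minus_zero_eq: "\<ominus> \<zero> = \<zero>"
  by (rule minus_equality) simp_all

text \<open>Purely additive normalisation rules for the \<open>algebra\<close> method, which proves
  \<open>telescope\<close> and \<open>cancel\<close> below.\<close>

lemmas (in abelian_group) group_simprules
  [algebra abelian_group "zero G" "add G" "a_inv G" "a_minus G"] =
  a_closed zero_closed a_inv_closed minus_closed a_assoc l_zero r_zero l_neg r_neg
  r_neg1 r_neg2 a_comm a_lcomm minus_eq minus_add minus_minus minus_zero_eq

text \<open>The hypotheses are Lie truss axioms read in a retract, with base point
  \<open>\<zero>\<close>; all that remains is computation in an abelian group.\<close>

lemma (in abelian_group) lie_ring_of_biaffine:
  fixes f
  defines "B \<equiv> \<lambda>a b. f a b \<ominus> f a \<zero> \<ominus> f \<zero> b"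
  assumes closed [simp]: "\<And>a b. \<lbrakk>a \<in> carrier G; b \<in> carrier G\<rbrakk> \<Longrightarrow> f a b \<in> carrier G"
    and left: "\<And>a b c d. \<lbrakk>a \<in> carrier G; b \<in> carrier G; c \<in> carrier G; d \<in> carrier G\<rbrakk>
      \<Longrightarrow> f (a \<ominus> b \<oplus> c) d = f a d \<ominus> f b d \<oplus> f c d"
    and right: "\<And>a b c d. \<lbrakk>a \<in> carrier G; b \<in> carrier G; c \<in> carrier G; d \<in> carrier G\<rbrakk>
      \<Longrightarrow> f d (a \<ominus> b \<oplus> c) = f d a \<ominus> f d b \<oplus> f d c"
    and idem: "\<And>a. a \<in> carrier G \<Longrightarrow> f a a = \<zero>"
    and anti: "\<And>a b. \<lbrakk>a \<in> carrier G; b \<in> carrier G\<rbrakk> \<Longrightarrow> f a b \<oplus> f b a = \<zero>"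
    and jacobi: "\<And>a b c. \<lbrakk>a \<in> carrier G; b \<in> carrier G; c \<in> carrier G\<rbrakk> \<Longrightarrow>
      f (f a b) c = f \<zero> a \<ominus> f (f b c) a \<oplus> f \<zero> b \<ominus> f (f c a) b \<oplus> f \<zero> c"
  shows "lie_ring G B"
proof -
  note norm = a_minus_def minus_add a_ac r_neg1 r_neg2 r_neg l_neg minus_zero_eq
  define R where "R x = f \<zero> x" for x
  have R [simp]: "R x \<in> carrier G" if "x \<in> carrier G" for x
    using that by (simp add: R_def)
  have f0: "f \<zero> x = R x" "f x \<zero> = \<ominus> R x" if "x \<in> carrier G" for x
    using that anti[of x \<zero>] by (simp_all add: R_def minus_equality)
  have R0 [simp]: "R \<zero> = \<zero>"
    using idem[of \<zero>] by (simp add: R_def)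
  have B: "B a b = f a b \<oplus> R a \<ominus> R b"
    if "a \<in> carrier G" "b \<in> carrier G" for a b
    using that by (simp add: B_def f0 a_minus_def)
  \<comment> \<open>An affine map is additive up to its value at \<open>\<zero>\<close>. This value
    is \<open>R d\<close> in the first slot and \<open>\<ominus> R d\<close> in the second, hence
    the opposite corrections in \<open>add_l\<close> and \<open>add_r\<close>.\<close>
  have add_l: "f (a \<oplus> b) d = f a d \<oplus> f b d \<ominus> R d"
    if "a \<in> carrier G" "b \<in> carrier G" "d \<in> carrier G" for a b d
    using that left[of a \<zero> b d] by (simp add: f0 norm)
  have add_r: "f d (a \<oplus> b) = f d a \<oplus> f d b \<oplus> R d"
    if "a \<in> carrier G" "b \<in> carrier G" "d \<in> carrier G" for a b d
    using that right[of a \<zero> b d] by (simp add: f0 norm)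
  have R_add: "R (a \<oplus> b) = R a \<oplus> R b"
    if "a \<in> carrier G" "b \<in> carrier G" for a b
    using that add_r[of a b \<zero>] by (simp add: f0)
  have R_neg: "R (\<ominus> a) = \<ominus> R a" if "a \<in> carrier G" for a
    using that R_add[of a "\<ominus> a"] by (metis R R0 a_inv_closed minus_equality a_comm r_neg)
  have neg_l: "f (\<ominus> a) d = R d \<oplus> R d \<ominus> f a d"
    if "a \<in> carrier G" "d \<in> carrier G" for a d
    using that left[of \<zero> a \<zero> d] by (simp add: f0 norm)
  txt \<open>The Jacobi identity at \<open>c = \<zero>\<close> says that \<open>R\<close> is a derivation of \<open>B\<close>.\<close>
  have R_f: "R (f a b) = f (R a) b \<ominus> f (R b) a \<oplus> R a \<ominus> R b"
    if a: "a \<in> carrier G" and b: "b \<in> carrier G" for a b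
  proof -
    have "\<ominus> R (f a b) = f (R b) a \<ominus> f (R a) b \<oplus> R b \<ominus> R a"
      using jacobi[of a b \<zero>] a b by (simp add: f0 neg_l norm)
    then have "\<ominus> (\<ominus> R (f a b)) = \<ominus> (f (R b) a \<ominus> f (R a) b \<oplus> R b \<ominus> R a)"
      by simp
    then show ?thesis
      using a b by (simp add: norm)
  qed
  txt \<open>In the cyclic sum of \<open>B (B a b) c\<close> the contributions \<open>W\<close> of \<open>R\<close> telescope.\<close>
  define W where "W a b c = f (R a) b \<oplus> f (R a) c \<oplus> R a \<oplus> R (R a)" for a b c
  have W [simp]: "W a b c \<in> carrier G"
    if "a \<in> carrier G" "b \<in> carrier G" "c \<in> carrier G" for a b c
    using that by (simp add: W_def)
  \<comment> \<open>After \<open>R_f\<close> has expanded \<open>R (f a b)\<close>, the terms built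
    from \<open>R a\<close> form \<open>W a b c\<close> and those built from \<open>R b\<close> form
    its cyclic shift \<open>W b c a\<close>.\<close>
  have BB: "B (B a b) c = f (f a b) c \<ominus> R c \<oplus> (W a b c \<ominus> W b c a)"
    if "a \<in> carrier G" "b \<in> carrier G" "c \<in> carrier G" for a b c
    using that by (simp add: B W_def add_l neg_l R_add R_neg R_f norm)
  have telescope: "(p \<oplus> (x \<ominus> y)) \<oplus> (q \<oplus> (y \<ominus> z)) \<oplus> (r \<oplus> (z \<ominus> x)) = p \<oplus> q \<oplus> r"
    if "p \<in> carrier G" "q \<in> carrier G" "r \<in> carrier G"
      "x \<in> carrier G" "y \<in> carrier G" "z \<in> carrier G" for p q r x y z
    using that by algebra
  \<comment> \<open>Here \<open>q\<close>, \<open>r\<close> stand for \<open>f (f b c) a\<close>,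
    \<open>f (f c a) b\<close> and \<open>x\<close>, \<open>y\<close>, \<open>z\<close> for
    \<open>R a\<close>, \<open>R b\<close>, \<open>R c\<close>; the innermost bracket is the
    right-hand side of \<open>jacobi\<close>.\<close>
  have cancel: "((x \<ominus> q \<oplus> y \<ominus> r \<oplus> z) \<ominus> z) \<oplus> (q \<ominus> x) \<oplus> (r \<ominus> y) = \<zero>"
    if "q \<in> carrier G" "r \<in> carrier G"
      "x \<in> carrier G" "y \<in> carrier G" "z \<in> carrier G" for q r x y z
    using that by algebra
  show ?thesis
  proof (unfold_locales, goal_cases)
    case (1 a b)
    then show ?case by (simp add: B)
  next
    case (2 a b c)
    then show ?case by (simp add: B add_l R_add norm)
  next
    case (3 a b c)
    then show ?case by (simp add: B add_r R_add norm)
  next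
    case (4 a)
    then show ?case by (simp add: B idem norm)
  next
    case (5 a b c)
    then show ?case
      using cancel[of "f (f b c) a" "f (f c a) b" "R a" "R b" "R c"]
      by (simp add: BB telescope jacobi[of a b c] f0)
  qed
qed

text \<open>The retract and its module version are records of different types with the same additive
  structure; this and the next lemma carry results from one to the other.\<close>

lemma abelian_group_cong:
  assumes "abelian_group L"
    and eq: "carrier L = carrier M" "\<zero>\<^bsub>L\<^esub> = \<zero>\<^bsub>M\<^esub>" "add L = add M"
  shows "abelian_group M"
proof -
  interpret L: abelian_group L by fact
  note [simp] = eq[symmetric]
  show ?thesis
  proof (rule abelian_groupI)
    fix x assume "x \<in> carrier M"
    then show "\<exists>y\<in>carrier M. y \<oplus>\<^bsub>M\<^esub> x = \<zero>\<^bsub>M\<^esub>"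
      using L.l_neg L.a_inv_closed by auto
  qed (simp_all add: L.a_ac)
qed

lemma lie_ring_cong:
  assumes "lie_ring L lb"
    and eq: "carrier L = carrier M" "\<zero>\<^bsub>L\<^esub> = \<zero>\<^bsub>M\<^esub>" "add L = add M"
  shows "lie_ring M lb"
  using assms abelian_group_cong[OF lie_ring.axioms(1)[OF assms(1)] eq]
  unfolding lie_ring_def lie_ring_axioms_def by simp

text \<open>By associativity the copies of \<open>u\<close> in the group expression cancel in
  pairs.\<close>

lemma (in abelian_heap) heap_eq_retract:
  assumes "u \<in> A" "a \<in> A" "b \<in> A" "c \<in> A"
  shows "h a b c = a \<ominus>\<^bsub>retract A h u\<^esub> b \<oplus>\<^bsub>retract A h u\<^esub> c"
proof -
  have "h (h a u (h u b u)) u c = h a b c"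
    using assms by (metis heap_assoc heap_closed heap_left_cancel heap_right_cancel)
  then show ?thesis
    using assms by (simp add: a_minus_def retract_a_inv) (simp add: retract_def)
qed

lemma (in lie_truss) retract_lie_ring:
  assumes u: "u \<in> A"
  shows "lie_ring (retract A h u) (retract_bracket A h br u)"
proof -
  let ?G = "retract A h u"
  interpret G: abelian_group ?G
    using u by (rule retract_abelian_group)
  have [simp]: "carrier ?G = A" "\<zero>\<^bsub>?G\<^esub> = u"
    by (simp_all add: retract_def)
  note hG = heap_eq_retract[OF u, symmetric]
  \<comment> \<open>The base point is written as the zero of the retract where it replaces an
    argument of the bracket, to match the form of \<open>B\<close> in the general lemma.\<close>
  have "lie_ring ?G (\<lambda>a b. br a u b \<ominus>\<^bsub>?G\<^esub> br a u \<zero>\<^bsub>?G\<^esub> \<ominus>\<^bsub>?G\<^esub> br \<zero>\<^bsub>?G\<^esub> u b)"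
  proof (rule G.lie_ring_of_biaffine, goal_cases)
    case (1 a b)
    then show ?case using u br_closed by simp
  next
    case (2 a b c d)
    then show ?case using br_hom1[OF u, of d] u br_closed by (simp add: hG heap_hom_def)
  next
    case (3 a b c d)
    then show ?case using br_hom3[of d u] u br_closed by (simp add: hG heap_hom_def)
  next
    case (4 a)
    then show ?case using u br_idem by simp
  next
    case (5 a b)
    then show ?case using u br_antisym[of a u b] by (simp add: retract_def)
  next
    case (6 a b c)
    then show ?case using u br_jacobi[of a b c u] br_closed heap_closed
      by (simp add: hG heap5_def)
  qed
  then show ?thesis
    by (simp add: retract_bracket_def[abs_def])
qed

lemma (in affine_space) retract_module:
  assumes u: "u \<in> A"
  shows "module F (retract_module A h \<Lambda> u)"
proof -
  have G: "abelian_group (retract_module A h \<Lambda> u)"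
    by (rule abelian_group_cong[OF retract_abelian_group[OF u]])
      (simp_all add: retract_def retract_module_def)
  \<comment> \<open>The sum is read as \<alpha> - 0 + \<beta>, and the scalar 0 sends
    \<open>x\<close> to \<open>u\<close>.\<close>
  have add: "\<Lambda> (\<alpha> \<oplus> \<beta>) u x = h (\<Lambda> \<alpha> u x) u (\<Lambda> \<beta> u x)"
    if "\<alpha> \<in> carrier F" "\<beta> \<in> carrier F" "x \<in> A" for \<alpha> \<beta> x
    using act_scalar_heap[of \<alpha> \<zero> \<beta> u x] act_zero[of u x] that u by (simp add: a_minus_def)
  \<comment> \<open>Needed for distributivity over vectors: \<open>act_heap\<close> leaves
    \<open>\<Lambda> \<alpha> u u\<close> in the middle of the heap operation.\<close>
  have base_fixed: "\<Lambda> \<alpha> u u = u" if "\<alpha> \<in> carrier F" for \<alpha>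
    using act_mult[of \<alpha> \<zero> u u] act_zero that u by simp
  show ?thesis
    by (rule moduleI[OF cring_axioms G])
      (auto simp: retract_module_def u add base_fixed act_closed act_mult act_heap act_one)
qed

lemma (in lie_affebra_heap) retract_lie_algebra:
  assumes u: "u \<in> A"
  shows "lie_algebra F (retract_module A h \<Lambda> u) (retract_bracket A h br u)"
proof -
  define G where "G = retract A h u"
  define M where "M = retract_module A h \<Lambda> u"
  have M: "carrier M = A" "\<zero>\<^bsub>M\<^esub> = u" "\<alpha> \<odot>\<^bsub>M\<^esub> x = \<Lambda> \<alpha> u x" for \<alpha> x
    by (simp_all add: M_def retract_module_def)
  have G: "carrier G = carrier M" "\<zero>\<^bsub>G\<^esub> = \<zero>\<^bsub>M\<^esub>" "add G = add M"
    by (simp_all add: G_def M_def retract_def retract_module_def)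
  interpret M: module F M
    unfolding M_def using u by (rule retract_module)
  interpret G: abelian_group G
    unfolding G_def using u by (rule retract_abelian_group)
  interpret lie_ring M "retract_bracket A h br u"
    by (rule lie_ring_cong[OF retract_lie_ring[OF u]]) (simp_all add: G[unfolded G_def])
  \<comment> \<open>The bracket subtracts in the retract, while scalars act on \<open>M\<close>; the
    two inverses must be identified.\<close>
  have inv: "\<ominus>\<^bsub>G\<^esub> x = \<ominus>\<^bsub>M\<^esub> x" if "x \<in> carrier M" for x
    using that by (intro G.minus_equality) (simp_all add: G M.l_neg)
  note heap = heap_eq_retract[OF u, folded G_def, folded M(1)]
    and brc [simp] = br_closed[folded M(1)]
    and idem = br_idem[folded M(1)]
    and base_change = act_base_change[folded M(1)]
    and affine1 = br_affine1[folded M(1)]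
    and affine3 = br_affine3[folded M(1)]
  have u' [simp]: "u \<in> carrier M"
    using u by (simp add: M)
  have act: "\<Lambda> \<alpha> a b = \<alpha> \<odot>\<^bsub>M\<^esub> b \<oplus>\<^bsub>M\<^esub> \<ominus>\<^bsub>M\<^esub> (\<alpha> \<odot>\<^bsub>M\<^esub> a) \<oplus>\<^bsub>M\<^esub> a"
    if "\<alpha> \<in> carrier F" "a \<in> carrier M" "b \<in> carrier M" for \<alpha> a b
    using that base_change[of \<alpha> a b u]
    by (simp add: heap a_minus_def inv G flip: M(3))
  have bracket: "retract_bracket A h br u a b =
      br a u b \<oplus>\<^bsub>M\<^esub> \<ominus>\<^bsub>M\<^esub> br a u u \<oplus>\<^bsub>M\<^esub> \<ominus>\<^bsub>M\<^esub> br u u b"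
    if "a \<in> carrier M" "b \<in> carrier M" for a b
    using that by (simp add: retract_bracket_def a_minus_def inv G flip: G_def)
  \<comment> \<open>Affinity moves the origin of the scaling from \<open>u\<close> to
    \<open>br u u b\<close>. The resulting extra copy of \<open>br u u b\<close> is cancelled by the
    last term of the bracket.\<close>
  have left: "br (\<alpha> \<odot>\<^bsub>M\<^esub> a) u b = \<Lambda> \<alpha> (br u u b) (br a u b)"
    if "\<alpha> \<in> carrier F" "a \<in> carrier M" "b \<in> carrier M" for \<alpha> a b
    using affine1[of u b] that by (simp add: affine_transformation_def M(3))
  have right: "br a u (\<alpha> \<odot>\<^bsub>M\<^esub> b) = \<Lambda> \<alpha> (br a u u) (br a u b)"
    if "\<alpha> \<in> carrier F" "a \<in> carrier M" "b \<in> carrier M" for \<alpha> a b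
    using affine3[of a u] that by (simp add: affine_transformation_def M(3))
  \<comment> \<open>When both other arguments are \<open>u\<close>, the new origin is again zero, so
    the two subtracted terms scale linearly.\<close>
  have idem_u: "br u u u = \<zero>\<^bsub>M\<^esub>"
    using idem[of u u] by (simp add: M(2))
  note norm = M.minus_add M.a_ac M.r_neg1 M.r_neg2 M.r_neg M.l_neg
    M.smult_r_distr M.smult_r_minus M.minus_zero_eq
  have "lie_algebra F M (retract_bracket A h br u)"
  proof (unfold_locales, goal_cases)
    case (1 \<alpha> a b)
    then show ?case
      by (simp add: bracket left act idem_u norm)
  next
    case (2 \<alpha> a b)
    then show ?case
      by (simp add: bracket right act idem_u norm)
  qed
  then show ?thesis
    by (simp add: M_def)
qed

theorem proposition3p6:
  fixes A :: "'a set" and h br :: "'a \<Rightarrow> 'a \<Rightarrow> 'a \<Rightarrow> 'a"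
    and F :: "('f, 'm) ring_scheme" and B :: "'b set" and k bs :: "'b \<Rightarrow> 'b \<Rightarrow> 'b \<Rightarrow> 'b"
    and \<Lambda> :: "'f \<Rightarrow> 'b \<Rightarrow> 'b \<Rightarrow> 'b"
  shows "(lie_truss A h br \<longrightarrow>
           (\<forall>u\<in>A. lie_ring (retract A h u) (retract_bracket A h br u))) \<and>
         (lie_affebra_heap F B k \<Lambda> bs \<longrightarrow>
           (\<forall>u\<in>B. lie_algebra F (retract_module B k \<Lambda> u) (retract_bracket B k bs u)))"
  by (simp add: lie_truss.retract_lie_ring lie_affebra_heap.retract_lie_algebra)

end
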